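(* Let $P$ be a finite poset on a set $S_P$ of $n$ elements, let $h: S_P \to \{1,2,\ldots,n\}$ be a bijection, and let $C_P \subseteq S_P \times S_P$ be a set of pairs of distinct elements satisfying: (1) if $x<y$ in $P$ and $h(x)<h(y)$, then $(x,y)\in C_P$; (2) if $(x,y)\in C_P$ then $h(x)<h(y)$; (3) if $(x,y)\in C_P$ and $(y,z)\in C_P$ then $(x,z)\in C_P$. Let $A'_k$ and $D'_k$ be as defined in the context. Set $\lambda_1 = A'_1$, $\mu_1 = D'_1$, and for $k\ge 2$ set $\lambda_k = A'_k - A'_{k-1}$, $\mu_k = D'_k - D'_{k-1}$. Then $n = \lambda_1+\lambda_2+\cdots$ and $n = \mu_1+\mu_2+\cdots$ are partitions of $n$ (i.e. the $\lambda_k$ and the $\mu_k$ are nonnegative integers, weakly decreasing in $k$, summing to $n$), and these two partitions are conjugate to each other.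
   Context: A sequence $s_1,\ldots,s_m$ of distinct elements of $S_P$ is called adjacentable if $(s_j,s_{j+1})\in C_P$ for every $1\le j\le m-1$, and $h$-ordered if $h(s_j)<h(s_{j+1})$ for every $j$. For an adjacentable sequence $S=(s_1,\ldots,s_m)$, $asc(S)$ is the number of indices $j$ with $s_j<s_{j+1}$ in $P$, plus one; $asc(S)=0$ if $S$ is empty. For an $h$-ordered sequence $S$, $desc(S)$ is the maximum length of a subsequence $s'_1,\ldots,s'_r$ of $S$ such that $s'_i \not< s'_j$ in $P$ for all $i<j$ (and $desc$ of the empty sequence is $0$). Two disjoint $h$-ordered sequences $(s_1,\ldots,s_m)$ and $(t_1,\ldots,t_l)$ are called semi-overlapping if there exist indices $i,j,k,l'$ with $(t_j,s_i)\in C_P$ and $(s_k,t_{l'})\in C_P$. $A'_k$ is the maximum, over all sets $\{S_1,\ldots,S_k\}$ of $k$ pairwise disjoint adjacentable sequences (sequences may be empty), of $asc(S_1)+\cdots+asc(S_k)$. $D'_k$ is the maximum, over all sets $\{S_1,\ldots,S_k\}$ of $k$ pairwise disjoint $h$-ordered sequences no two of which are semi-overlapping, of $desc(S_1)+\cdots+desc(S_k)$. *)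

theory Defs
  imports Main "HOL-Library.Sublist"
begin

text \<open>
  A finite poset on \<open>S\<close> is given by its reflexive order relation \<open>r\<close> with
  \<^term>\<open>partial_order_on S r\<close>; \<open>x < y\<close> in the poset is \<open>(x, y) \<in> r - Id\<close>.
  Sequences are lists.
\<close>

definition adjacentable :: "'a set \<Rightarrow> 'a rel \<Rightarrow> 'a list \<Rightarrow> bool" where
  "adjacentable S C xs \<longleftrightarrow>
     set xs \<subseteq> S \<and> distinct xs \<and> successively (\<lambda>x y. (x, y) \<in> C) xs"

definition h_ordered :: "'a set \<Rightarrow> ('a \<Rightarrow> nat) \<Rightarrow> 'a list \<Rightarrow> bool" where
  "h_ordered S h xs \<longleftrightarrow>
     set xs \<subseteq> S \<and> distinct xs \<and> successively (\<lambda>x y. h x < h y) xs"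

definition asc :: "'a rel \<Rightarrow> 'a list \<Rightarrow> nat" where
  "asc r xs =
     (if xs = [] then 0
      else card {j. Suc j < length xs \<and> (xs ! j, xs ! Suc j) \<in> r - Id} + 1)"

definition desc :: "'a rel \<Rightarrow> 'a list \<Rightarrow> nat" where
  "desc r xs =
     Max {length ys |ys. subseq ys xs \<and> sorted_wrt (\<lambda>x y. (x, y) \<notin> r - Id) ys}"

definition semi_overlapping :: "'a rel \<Rightarrow> 'a list \<Rightarrow> 'a list \<Rightarrow> bool" where
  "semi_overlapping C ss ts \<longleftrightarrow>
     (\<exists>t\<in>set ts. \<exists>s\<in>set ss. (t, s) \<in> C) \<and> (\<exists>s\<in>set ss. \<exists>t\<in>set ts. (s, t) \<in> C)"

text \<open>
  A family of \<open>k\<close> sequences is a list of length \<open>k\<close>, so that the empty sequence may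
  occur several times.
\<close>

definition pairwise_disjoint :: "'a list list \<Rightarrow> bool" where
  "pairwise_disjoint Ss \<longleftrightarrow>
     (\<forall>i<length Ss. \<forall>j<length Ss. i \<noteq> j \<longrightarrow> set (Ss ! i) \<inter> set (Ss ! j) = {})"

definition A_families :: "'a set \<Rightarrow> 'a rel \<Rightarrow> nat \<Rightarrow> 'a list list set" where
  "A_families S C k =
     {Ss. length Ss = k \<and> (\<forall>xs\<in>set Ss. adjacentable S C xs) \<and> pairwise_disjoint Ss}"

definition D_families :: "'a set \<Rightarrow> ('a \<Rightarrow> nat) \<Rightarrow> 'a rel \<Rightarrow> nat \<Rightarrow> 'a list list set" where
  "D_families S h C k =
     {Ss. length Ss = k \<and> (\<forall>xs\<in>set Ss. h_ordered S h xs) \<and> pairwise_disjoint Ss \<and>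
          (\<forall>i<k. \<forall>j<k. i \<noteq> j \<longrightarrow> \<not> semi_overlapping C (Ss ! i) (Ss ! j))}"

definition A' :: "'a set \<Rightarrow> 'a rel \<Rightarrow> 'a rel \<Rightarrow> nat \<Rightarrow> nat" where
  "A' S r C k = Max ((\<lambda>Ss. \<Sum>xs\<leftarrow>Ss. asc r xs) ` A_families S C k)"

definition D' :: "'a set \<Rightarrow> 'a rel \<Rightarrow> ('a \<Rightarrow> nat) \<Rightarrow> 'a rel \<Rightarrow> nat \<Rightarrow> nat" where
  "D' S r h C k = Max ((\<lambda>Ss. \<Sum>xs\<leftarrow>Ss. desc r xs) ` D_families S h C k)"

text \<open>
  Partitions are integer sequences indexed from 1 with finitely many nonzero terms; the
  value at index 0 is irrelevant.
\<close>

definition is_partition :: "nat \<Rightarrow> (nat \<Rightarrow> int) \<Rightarrow> bool" where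
  "is_partition n a \<longleftrightarrow>
     (\<forall>k\<ge>1. 0 \<le> a k) \<and> (\<forall>k\<ge>1. a (Suc k) \<le> a k) \<and>
     finite {k. 1 \<le> k \<and> a k \<noteq> 0} \<and> (\<Sum>k | 1 \<le> k \<and> a k \<noteq> 0. a k) = int n"

definition conjugate_of :: "(nat \<Rightarrow> int) \<Rightarrow> (nat \<Rightarrow> int) \<Rightarrow> bool" where
  "conjugate_of b a \<longleftrightarrow> (\<forall>j\<ge>1. b j = int (card {i. 1 \<le> i \<and> int j \<le> a i}))"

text \<open>The sets whose maximum is taken above are finite and nonempty.\<close>

lemma desc_set_wf:
  "finite {length ys |ys. subseq ys xs \<and> sorted_wrt (\<lambda>x y. (x, y) \<notin> r - Id) ys}"
  "{length ys |ys. subseq ys xs \<and> sorted_wrt (\<lambda>x y. (x, y) \<notin> r - Id) ys} \<noteq> {}"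
proof -
  have "{length ys |ys. subseq ys xs \<and> sorted_wrt (\<lambda>x y. (x, y) \<notin> r - Id) ys} \<subseteq> {..length xs}"
    by (auto dest: list_emb_length)
  then show "finite {length ys |ys. subseq ys xs \<and> sorted_wrt (\<lambda>x y. (x, y) \<notin> r - Id) ys}"
    by (rule finite_subset) simp
  show "{length ys |ys. subseq ys xs \<and> sorted_wrt (\<lambda>x y. (x, y) \<notin> r - Id) ys} \<noteq> {}"
    by (auto intro!: exI[of _ "[]"])
qed

lemma finite_families:
  assumes "finite S"
  shows "finite {Ss. length Ss = k \<and> (\<forall>xs\<in>set Ss. set xs \<subseteq> S \<and> distinct xs)}"
proof -
  have "finite {xs. set xs \<subseteq> S \<and> distinct xs}"
    using assms by (rule finite_subset_distinct)
  then have "finite {Ss. set Ss \<subseteq> {xs. set xs \<subseteq> S \<and> distinct xs} \<and> length Ss = k}"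
    by (rule finite_lists_length_eq)
  then show ?thesis
    by (rule rev_finite_subset) auto
qed

lemma A_families_wf:
  assumes "finite S"
  shows "finite (A_families S C k)" "A_families S C k \<noteq> {}"
proof -
  show "finite (A_families S C k)"
    by (rule finite_subset[OF _ finite_families[OF assms, of k]])
       (auto simp: A_families_def adjacentable_def)
  have "replicate k [] \<in> A_families S C k"
    by (auto simp: A_families_def adjacentable_def pairwise_disjoint_def)
  then show "A_families S C k \<noteq> {}" by blast
qed

lemma D_families_wf:
  assumes "finite S"
  shows "finite (D_families S h C k)" "D_families S h C k \<noteq> {}"
proof -
  show "finite (D_families S h C k)"
    by (rule finite_subset[OF _ finite_families[OF assms, of k]])
       (auto simp: D_families_def h_ordered_def)
  have "replicate k [] \<in> D_families S h C k"
    by (auto simp: D_families_def h_ordered_def pairwise_disjoint_def semi_overlapping_def)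
  then show "D_families S h C k \<noteq> {}" by blast
qed

end

theory Submission
  imports Defs
begin

text \<open>
  Let \<open>Q\<close> be the set of pairs of \<open>C\<close> that are increasing in the poset. A \<open>C\<close>-chain meets a
  family of \<open>l\<close> pairwise non-semi-overlapping \<open>Q\<close>-antichains in contiguous blocks, and two
  consecutive elements of a block are separated by a non-\<open>Q\<close> step of the chain. Counting gives
  the weak duality \<open>A'\<^sub>k + D'\<^sub>l \<le> n + k l\<close>.

  A family of \<open>k\<close> disjoint \<open>C\<close>-chains is the same as a matching with \<open>n - k\<close> edges between two
  copies of \<open>S\<close>, where a loop marks an unused element, and optimal duals of the
  corresponding assignment problem yield antichain families: for each \<open>k\<close> some \<open>l\<close>, and for
  each \<open>l\<close> some \<open>k\<close>, attains equality in the weak duality. This forces both sequences to be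
  concave and their differences to be conjugate.
\<close>

section \<open>Duality for the assignment problem\<close>

text \<open>Induction on \<open>card L\<close>. If a nonempty proper subset has exactly as many
  neighbours as elements, it is matched separately from its complement; otherwise every such subset
  has a spare neighbour, and an arbitrary edge can be fixed.\<close>

lemma hall_marriage:
  fixes E :: "('b \<times> 'c) set"
  assumes "finite L" and "finite E"
    and "\<And>X. X \<subseteq> L \<Longrightarrow> card X \<le> card (E `` X)"
  shows "\<exists>f. inj_on f L \<and> (\<forall>x\<in>L. (x, f x) \<in> E)"
  using assms
proof (induction "card L" arbitrary: L E rule: less_induct)
  case less
  note fin = \<open>finite L\<close> \<open>finite E\<close> and hall = less.prems(3)
  have finI: "finite (E `` X)" for X
    using fin(2) by (rule finite_Image)
  consider (empty) "L = {}"
    | (critical) X where "X \<subset> L" "X \<noteq> {}" "card (E `` X) = card X"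
    | (surplus) "L \<noteq> {}" "\<And>X. X \<subset> L \<Longrightarrow> X \<noteq> {} \<Longrightarrow> card X < card (E `` X)"
    using hall by (metis le_neq_implies_less psubset_imp_subset)
  then show ?case
  proof cases
    case empty
    then show ?thesis by auto
  next
    case critical
    \<comment> \<open>Deleting all neighbours of \<open>X\<close> preserves the Hall condition: the
      neighbours of \<open>X \<union> Y\<close> split into those of \<open>X\<close>, exactly
      \<open>card X\<close> many, and the surviving ones of \<open>Y\<close>.\<close>
    let ?E' = "E - UNIV \<times> E `` X"
    have finX: "finite X"
      using critical(1) fin(1) by (meson finite_subset psubset_imp_subset)
    obtain f where f: "inj_on f X" "\<forall>x\<in>X. (x, f x) \<in> E"
      using less.hyps[of X E] critical(1) fin hall psubset_card_mono[OF fin(1) critical(1)] finX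
      by (meson order_trans psubset_imp_subset)
    have "card (L - X) < card L"
      using critical(1,2) fin(1) by (intro psubset_card_mono) auto
    moreover have "card Y \<le> card (?E' `` Y)" if Y: "Y \<subseteq> L - X" for Y
    proof -
      have finY: "finite Y" using Y fin(1) by (meson finite_Diff finite_subset)
      have "card X + card Y = card (X \<union> Y)"
        using Y finX finY by (subst card_Un_disjoint) auto
      also have "\<dots> \<le> card (E `` (X \<union> Y))"
        using Y critical(1) by (intro hall) auto
      also have "E `` (X \<union> Y) = E `` X \<union> ?E' `` Y" by auto
      also have "card \<dots> = card (E `` X) + card (?E' `` Y)"
        using finI fin(2) by (intro card_Un_disjoint) auto
      finally show ?thesis using critical(3) by simp
    qed
    ultimately obtain g where g: "inj_on g (L - X)" "\<forall>x\<in>L - X. (x, g x) \<in> ?E'"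
      using less.hyps[of "L - X" ?E'] fin by (meson finite_Diff)
    let ?k = "\<lambda>x. if x \<in> X then f x else g x"
    have "inj_on ?k L"
    proof (rule inj_onI)
      fix x y assume xy: "x \<in> L" "y \<in> L" "?k x = ?k y"
      have "g b \<noteq> f a" if "a \<in> X" "b \<in> L - X" for a b
      proof -
        have "f a \<in> E `` X" using f(2) that by blast
        moreover have "g b \<notin> E `` X" using g(2) that by blast
        ultimately show ?thesis by metis
      qed
      then show "x = y"
        using xy inj_onD[OF f(1), of x y] inj_onD[OF g(1), of x y]
        by (cases "x \<in> X"; cases "y \<in> X") force+
    qed
    moreover have "\<forall>x\<in>L. (x, ?k x) \<in> E" using f(2) g(2) by auto
    ultimately show ?thesis by blast
  next
    case surplus
    then obtain x where x: "x \<in> L" by blast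
    have "card {x} \<le> card (E `` {x})" using x by (intro hall) auto
    then have "E `` {x} \<noteq> {}" by auto
    then obtain y where y: "(x, y) \<in> E" by blast
    \<comment> \<open>Deleting \<open>y\<close> costs a set at most one neighbour, which the strict
      surplus covers.\<close>
    let ?E' = "E - UNIV \<times> {y}"
    have "card Y \<le> card (?E' `` Y)" if Y: "Y \<subseteq> L - {x}" for Y
    proof (cases "Y = {}")
      case False
      have "card Y < card (E `` Y)" using surplus(2)[of Y] Y False x by blast
      moreover have "card (E `` Y) \<le> card (insert y (?E' `` Y))"
        using fin(2) by (intro card_mono) auto
      moreover have "card (insert y (?E' `` Y)) \<le> Suc (card (?E' `` Y))"
        using fin(2) by (simp add: card_insert_if)
      ultimately show ?thesis by linarith
    qed auto
    moreover have "card (L - {x}) < card L"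
      using x fin(1) by (intro psubset_card_mono) auto
    ultimately obtain f where f: "inj_on f (L - {x})" "\<forall>z\<in>L - {x}. (z, f z) \<in> ?E'"
      using less.hyps[of "L - {x}" ?E'] fin by (meson finite_Diff)
    have "y \<notin> f ` (L - {x})" using f(2) by auto
    then have "inj_on (f(x := y)) L"
      using f(1) by (auto simp: inj_on_def)
    moreover have "\<forall>z\<in>L. (z, (f(x := y)) z) \<in> E" using f(2) y by auto
    ultimately show ?thesis by blast
  qed
qed

text \<open>
  A feasible integral dual of least value must be tight along a perfect matching: a Hall
  violator \<open>X\<close> in the graph of tight edges could be used to decrease the dual value.
\<close>

lemma assignment_duality:
  fixes w :: "'b \<Rightarrow> 'c \<Rightarrow> int"
  assumes fin: "finite L" "finite R" and E: "E \<subseteq> L \<times> R"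
    and g: "bij_betw g L R" "\<And>x. x \<in> L \<Longrightarrow> (x, g x) \<in> E"
  obtains f u v where "bij_betw f L R" "\<And>x. x \<in> L \<Longrightarrow> (x, f x) \<in> E"
    "\<And>x y. (x, y) \<in> E \<Longrightarrow> w x y \<le> u x + v y"
    "\<And>x. x \<in> L \<Longrightarrow> u x + v (f x) = w x (f x)"
proof -
  define feas :: "('b \<Rightarrow> int) \<times> ('c \<Rightarrow> int) \<Rightarrow> bool" where "feas = (\<lambda>(u, v). \<forall>x y. (x, y) \<in> E \<longrightarrow> w x y \<le> u x + v y)"
  define val :: "('b \<Rightarrow> int) \<times> ('c \<Rightarrow> int) \<Rightarrow> int" where "val = (\<lambda>(u, v). sum u L + sum v R)"
  \<comment> \<open>On feasible pairs this gap is nonnegative by weak duality, so an integral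
    minimiser of \<open>val\<close> exists by well-ordering.\<close>
  define m where "m = (\<lambda>p. nat (val p - (\<Sum>x\<in>L. w x (g x))))"
  have lower: "(\<Sum>x\<in>L. w x (g x)) \<le> val p" if "feas p" for p
  proof -
    obtain u v where p: "p = (u, v)" by fastforce
    have "sum v R = (\<Sum>x\<in>L. v (g x))"
      using sum.reindex_bij_betw[OF g(1), of v] by simp
    then have "val p = (\<Sum>x\<in>L. u x + v (g x))"
      by (simp add: p val_def sum.distrib)
    moreover have "(\<Sum>x\<in>L. w x (g x)) \<le> (\<Sum>x\<in>L. u x + v (g x))"
      using that g(2) by (intro sum_mono) (auto simp: feas_def p)
    ultimately show ?thesis by simp
  qed
  have "feas (\<lambda>x. \<Sum>y\<in>R. \<bar>w x y\<bar>, \<lambda>_. 0)"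
  proof -
    have "w x y \<le> (\<Sum>y\<in>R. \<bar>w x y\<bar>)" if "(x, y) \<in> E" for x y
    proof -
      have "\<bar>w x y\<bar> \<le> (\<Sum>y\<in>R. \<bar>w x y\<bar>)"
        using that E fin by (intro member_le_sum) auto
      then show ?thesis by linarith
    qed
    then show ?thesis by (auto simp: feas_def)
  qed
  then obtain p where p: "feas p" "\<And>q. feas q \<Longrightarrow> m p \<le> m q"
    using ex_has_least_nat[of feas _ m] by blast
  have minimal: "val p \<le> val q" if "feas q" for q
    using p(2)[OF that] lower[OF that] lower[OF p(1)] unfolding m_def by linarith
  obtain u v where uv: "p = (u, v)" by fastforce
  have uv_feas: "w x y \<le> u x + v y" if "(x, y) \<in> E" for x y
    using p(1) that by (auto simp: feas_def uv)
  define T where "T = {(x, y) \<in> E. u x + v y = w x y}"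
  have "finite E" using E fin by (meson finite_SigmaI finite_subset)
  then have finT: "finite T" by (rule rev_finite_subset) (auto simp: T_def)
  have "card X \<le> card (T `` X)" if X: "X \<subseteq> L" for X
  proof (rule ccontr)
    assume viol: "\<not> card X \<le> card (T `` X)"
    \<comment> \<open>Only edges from \<open>X\<close> to vertices outside its tight neighbourhood
      lose a unit; they are not tight, so by integrality they have one to spare. The value drops by
      \<open>card X\<close> minus the number of tight neighbours.\<close>
    let ?u = "\<lambda>x. u x - of_bool (x \<in> X)" and ?v = "\<lambda>y. v y + of_bool (y \<in> T `` X)"
    have "w x y \<le> ?u x + ?v y" if "(x, y) \<in> E" for x y
    proof (cases "x \<in> X \<and> y \<notin> T `` X")
      case True
      then have "u x + v y \<noteq> w x y" using that by (auto simp: T_def)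
      then show ?thesis using uv_feas[OF that] True by simp
    next
      case False
      then show ?thesis using uv_feas[OF that] by auto
    qed
    then have "feas (?u, ?v)" unfolding feas_def prod.case by blast
    then have "val p \<le> val (?u, ?v)" by (rule minimal)
    moreover have "(\<Sum>x\<in>L. of_bool (x \<in> X) :: int) = int (card X)"
      using X fin by (simp add: of_bool_def sum.If_cases Int_absorb1 Collect_mem_eq)
    moreover have "T `` X \<subseteq> R" using E by (auto simp: T_def)
    then have "(\<Sum>y\<in>R. of_bool (y \<in> T `` X) :: int) = int (card (T `` X))"
      using fin by (simp add: of_bool_def sum.If_cases Int_absorb1 Collect_mem_eq del: Image_iff)
    ultimately show False
      using viol by (simp add: val_def uv sum_subtractf sum.distrib del: Image_iff)
  qed
  then obtain f where f: "inj_on f L" "\<forall>x\<in>L. (x, f x) \<in> T"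
    using hall_marriage[OF fin(1) finT] by blast
  have "f ` L \<subseteq> R" using f(2) E by (auto simp: T_def)
  moreover have "card (f ` L) = card R"
    using card_image[OF f(1)] bij_betw_same_card[OF g(1)] by simp
  ultimately have "bij_betw f L R"
    using f(1) fin(2) by (simp add: bij_betw_def card_subset_eq)
  then show thesis
    using f(2) uv_feas by (intro that[of f u v]) (auto simp: T_def)
qed

section \<open>Conjugate partitions from tight pairs\<close>

text \<open>A discrete Legendre pair: \<open>A k\<close> is the minimum over \<open>l\<close> of
  \<open>n + k * l - D l\<close>, and symmetrically for \<open>D\<close>. Minima of affine functions
  are concave, which makes the slopes weakly decreasing.\<close>

locale tight_pairs =
  fixes A D :: "nat \<Rightarrow> int" and n :: nat
  assumes A0: "A 0 = 0" and D0: "D 0 = 0"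
    and weak: "\<And>k l. A k + D l \<le> int n + int k * int l"
    and tight_A: "\<And>k. \<exists>l. A k + D l = int n + int k * int l"
    and tight_D: "\<And>l. \<exists>k. A k + D l = int n + int k * int l"
begin

text \<open>A tight \<open>l\<close> is a supergradient of \<open>A\<close> at \<open>k\<close>:
  comparing with \<open>weak\<close> at the neighbours of \<open>k\<close> shows that
  \<open>l\<close> separates the two adjacent slopes.\<close>

lemma tight_diff:
  assumes "A k + D l = int n + int k * int l"
  shows "A (Suc k) - A k \<le> int l" and "k \<ge> 1 \<Longrightarrow> int l \<le> A k - A (k - 1)"
proof -
  show "A (Suc k) - A k \<le> int l"
    using assms weak[of "Suc k" l] by (simp add: algebra_simps)
  show "int l \<le> A k - A (k - 1)" if "k \<ge> 1"
    using assms weak[of "k - 1" l] that by (simp add: algebra_simps of_nat_diff)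
qed

lemma diff_nonneg: "k \<ge> 1 \<Longrightarrow> 0 \<le> A k - A (k - 1)"
proof -
  assume k: "k \<ge> 1"
  obtain l where "A k + D l = int n + int k * int l" using tight_A by blast
  from tight_diff(2)[OF this k] show ?thesis by simp
qed

lemma diff_antimono: "k \<ge> 1 \<Longrightarrow> A (Suc k) - A k \<le> A k - A (k - 1)"
proof -
  assume k: "k \<ge> 1"
  obtain l where "A k + D l = int n + int k * int l" using tight_A by blast
  from tight_diff(1)[OF this] tight_diff(2)[OF this k] show ?thesis by simp
qed

lemma diff_antimono_le: "i \<le> k \<Longrightarrow> 1 \<le> i \<Longrightarrow> A k - A (k - 1) \<le> A i - A (i - 1)"
proof (induction k rule: dec_induct)
  case (step k)
  then show ?case using diff_antimono[of k] by simp
qed simp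

text \<open>By concavity every increment from \<open>k\<close> up to \<open>i\<close> is at least
  the last one, hence at least \<open>a\<close>.\<close>

lemma increment_lower_bound:
  assumes "1 \<le> i" "k \<le> i" "a \<le> A i - A (i - 1)"
  shows "A k + (int i - int k) * a \<le> A i"
proof -
  have "A k + (int j - int k) * a \<le> A j" if "k \<le> j" "j \<le> i" for j
    using that
  proof (induction j rule: dec_induct)
    case (step j)
    then have "a \<le> A (Suc j) - A j"
      using diff_antimono_le[of "Suc j" i] assms(3) by simp
    then show ?case using step by (simp add: algebra_simps)
  qed simp
  then show ?thesis using assms(2) by simp
qed

lemma is_partition_diff:
  assumes lam: "\<And>k. k \<ge> 1 \<Longrightarrow> lam k = A k - A (k - 1)"
  shows "is_partition n lam"
proof -
  \<comment> \<open>Tightness for \<open>l = 0\<close> gives an index where \<open>A\<close> reaches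
    \<open>n\<close>; as \<open>weak\<close> for \<open>l = 0\<close> bounds \<open>A\<close> by
    \<open>n\<close>, the monotone \<open>A\<close> is constant from there on.\<close>
  obtain k0 where k0: "A k0 = int n"
    using tight_D[of 0] D0 by auto
  have A_le: "A k \<le> int n" for k
    using weak[of k 0] D0 by simp
  have An: "A k = int n" if "k0 \<le> k" for k
    using that
  proof (induction k rule: dec_induct)
    case (step k)
    then show ?case using diff_nonneg[of "Suc k"] A_le[of "Suc k"] by simp
  qed (rule k0)
  have supp: "{k. 1 \<le> k \<and> lam k \<noteq> 0} \<subseteq> {1..k0}"
  proof
    fix k assume "k \<in> {k. 1 \<le> k \<and> lam k \<noteq> 0}"
    then have k: "1 \<le> k" "A k \<noteq> A (k - 1)" using lam[of k] by auto
    have "\<not> k0 \<le> k - 1" using An[of k] An[of "k - 1"] k by auto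
    then show "k \<in> {1..k0}" using k(1) by auto
  qed
  have "(\<Sum>k | 1 \<le> k \<and> lam k \<noteq> 0. lam k) = (\<Sum>k=1..k0. lam k)"
    using supp by (intro sum.mono_neutral_left) auto
  also have "\<dots> = (\<Sum>k=1..k0. A k - A (k - 1))"
    using lam by (intro sum.cong) auto
  also have "\<dots> = A k0"
    by (induction k0) (auto simp: A0)
  finally have "(\<Sum>k | 1 \<le> k \<and> lam k \<noteq> 0. lam k) = int n"
    using k0 by simp
  moreover have "finite {k. 1 \<le> k \<and> lam k \<noteq> 0}"
    using supp by (rule finite_subset) simp
  ultimately show ?thesis
    using diff_nonneg diff_antimono by (auto simp: is_partition_def lam)
qed

end

text \<open>The axioms are symmetric in \<open>A\<close> and \<open>D\<close>, so the results on the
  slopes of \<open>A\<close> carry over to \<open>D\<close>.\<close>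

sublocale tight_pairs \<subseteq> swap: tight_pairs D A n
proof
  show "D k + A l \<le> int n + int k * int l" for k l
    using weak[of l k] by (simp add: algebra_simps)
  show "\<exists>l. D k + A l = int n + int k * int l" for k
    using tight_D[of k] by (simp add: algebra_simps)
  show "\<exists>k. D k + A l = int n + int k * int l" for l
    using tight_A[of l] by (simp add: algebra_simps)
qed (rule D0 A0)+

context tight_pairs
begin

text \<open>A cell \<open>(i, j)\<close> of the Young diagram of \<open>A\<close> has its transpose
  in that of \<open>D\<close>. If \<open>k\<close> is tight for \<open>j\<close> and
  \<open>i \<le> k\<close>, this holds because \<open>k\<close> is a supergradient of
  \<open>D\<close> at \<open>j\<close>; otherwise tightness is carried from \<open>k\<close> to
  \<open>i\<close>.\<close>

lemma diff_ge_imp: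
  assumes "1 \<le> i" "1 \<le> j" and le: "int j \<le> A i - A (i - 1)"
  shows "int i \<le> D j - D (j - 1)"
proof -
  obtain k where k: "A k + D j = int n + int k * int j"
    using tight_D by blast
  show ?thesis
  proof (cases "i \<le> k")
    case True
    have "int k \<le> D j - D (j - 1)"
      using swap.tight_diff(2)[of j k] k assms(2) by (simp add: algebra_simps)
    then show ?thesis using True by simp
  next
    case False
    \<comment> \<open>Increments of at least \<open>j\<close> keep up with the growth of the bound
      in \<open>weak\<close>, so equality persists at \<open>i\<close>.\<close>
    have "A k + (int i - int k) * int j \<le> A i"
      using False assms by (intro increment_lower_bound) auto
    then have "A i + D j = int n + int i * int j"
      using k weak[of i j] by (simp add: algebra_simps)
    then show ?thesis
      using swap.tight_diff(2)[of j i] assms(2) by (simp add: algebra_simps)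
  qed
qed

end

context tight_pairs
begin

lemma conjugate_of_diff:
  assumes lam: "\<And>k. k \<ge> 1 \<Longrightarrow> lam k = A k - A (k - 1)"
    and mu: "\<And>k. k \<ge> 1 \<Longrightarrow> mu k = D k - D (k - 1)"
  shows "conjugate_of mu lam"
  unfolding conjugate_of_def
proof (intro allI impI)
  fix j :: nat assume j: "1 \<le> j"
  have "int j \<le> lam i \<longleftrightarrow> int i \<le> mu j" if "1 \<le> i" for i
    using diff_ge_imp[of i j] swap.diff_ge_imp[of j i] that j lam mu by auto
  \<comment> \<open>Transposition works both ways, so the condition on \<open>i\<close> cuts out an
    initial segment of length \<open>mu j\<close>.\<close>
  then have "{i. 1 \<le> i \<and> int j \<le> lam i} = {1..nat (mu j)}"
    by auto
  moreover have "0 \<le> mu j" using swap.diff_nonneg[of j] mu j by simp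
  ultimately show "mu j = int (card {i. 1 \<le> i \<and> int j \<le> lam i})" by simp
qed

end

section \<open>Chains and antichains\<close>

lemma asc_Nil [simp]: "asc r [] = 0"
  by (simp add: asc_def)

lemma asc_singleton [simp]: "asc r [x] = 1"
  by (simp add: asc_def)

lemma asc_Cons_Cons:
  "asc r (x # y # ys) = asc r (y # ys) + of_bool ((x, y) \<in> r - Id)"
proof -
  let ?J = "\<lambda>xs. {j. Suc j < length xs \<and> (xs ! j, xs ! Suc j) \<in> r - Id}"
  have "?J (x # y # ys) = (if (x, y) \<in> r - Id then {0} else {}) \<union> Suc ` ?J (y # ys)"
  proof (rule set_eqI)
    fix j show "j \<in> ?J (x # y # ys) \<longleftrightarrow>
      j \<in> (if (x, y) \<in> r - Id then {0} else {}) \<union> Suc ` ?J (y # ys)"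
      by (cases j) auto
  qed
  moreover have "finite (?J (y # ys))"
    by (rule finite_subset[of _ "{..length (y # ys)}"]) auto
  ultimately have "card (?J (x # y # ys)) = card (?J (y # ys)) + of_bool ((x, y) \<in> r - Id)"
    by (simp add: card_image card_insert_if image_iff)
  then show ?thesis by (simp add: asc_def)
qed

lemma asc_snoc:
  "xs \<noteq> [] \<Longrightarrow> asc r (xs @ [z]) = asc r xs + of_bool ((last xs, z) \<in> r - Id)"
proof (induction xs)
  case (Cons x xs)
  then show ?case by (cases xs) (simp_all add: asc_Cons_Cons)
qed simp

text \<open>Chain families are built with \<open>distinct (concat Ss)\<close>, which is easy to
  maintain in an induction and lets empty sequences repeat.\<close>

lemma pairwise_disjoint_if_distinct_concat:
  "distinct (concat Ss) \<Longrightarrow> pairwise_disjoint Ss"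
proof (induction Ss)
  case (Cons xs Ss)
  then have IH: "pairwise_disjoint Ss" and disj: "\<And>ys. ys \<in> set Ss \<Longrightarrow> set xs \<inter> set ys = {}"
    by auto
  show ?case
    unfolding pairwise_disjoint_def
  proof (intro allI impI)
    fix i j assume ij: "i < length (xs # Ss)" "j < length (xs # Ss)" "i \<noteq> j"
    show "set ((xs # Ss) ! i) \<inter> set ((xs # Ss) ! j) = {}"
      using ij IH disj disj[unfolded Int_commute[of "set xs"]]
      by (cases i; cases j) (auto simp: pairwise_disjoint_def)
  qed
qed (simp add: pairwise_disjoint_def)

text \<open>\<open>C\<close> is a strict order with linear extension \<open>h\<close>; it contains
  the pairs of the poset that \<open>h\<close> respects and possibly others.\<close>

locale refined_order =
  fixes S :: "'a set" and r C :: "'a rel" and h :: "'a \<Rightarrow> nat" and n :: nat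
  assumes fin: "finite S" and card_S: "card S = n" and po: "partial_order_on S r"
    and h: "bij_betw h S {1..n}"
    and C_sub: "C \<subseteq> S \<times> S"
    and r_C: "\<And>x y. (x, y) \<in> r - Id \<Longrightarrow> h x < h y \<Longrightarrow> (x, y) \<in> C"
    and C_h: "\<And>x y. (x, y) \<in> C \<Longrightarrow> h x < h y"
    and C_trans: "\<And>x y z. (x, y) \<in> C \<Longrightarrow> (y, z) \<in> C \<Longrightarrow> (x, z) \<in> C"
begin

text \<open>Both statistics only see \<open>Q\<close>: a step of a \<open>C\<close>-chain is an
  ascent iff it lies in \<open>Q\<close>, and a pair in the order of an \<open>h\<close>-ordered
  list increases in the poset iff it lies in \<open>Q\<close>.\<close>

definition Q :: "'a rel" where
  "Q = (r - Id) \<inter> C"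

lemma Q_trans: "(x, y) \<in> Q \<Longrightarrow> (y, z) \<in> Q \<Longrightarrow> (x, z) \<in> Q"
proof -
  assume a: "(x, y) \<in> Q" "(y, z) \<in> Q"
  then have "(x, z) \<in> C" by (auto simp: Q_def intro: C_trans)
  moreover have "(x, z) \<in> r"
    using po a by (auto simp: Q_def partial_order_on_def preorder_on_def dest: transD)
  ultimately show ?thesis using C_h by (auto simp: Q_def)
qed

lemma C_irrefl: "(x, x) \<notin> C"
  using C_h by blast

text \<open>
  \<open>c\<close> labels each element of \<open>X\<close> by the antichain containing it. The second conjunct is the
  invariant that makes the induction work: there is slack one if the initial maximal
  \<open>Q\<close>-run avoids \<open>X\<close>.
\<close>

lemma chain_meets_antichains:
  assumes Qc: "\<And>x y. (x, y) \<in> Q \<Longrightarrow> x \<in> X \<Longrightarrow> y \<in> X \<Longrightarrow> c x \<noteq> c y"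
    and Cc: "\<And>x y z. (x, y) \<in> C \<Longrightarrow> (y, z) \<in> C \<Longrightarrow> x \<in> X \<Longrightarrow> y \<in> X \<Longrightarrow> z \<in> X \<Longrightarrow>
                c x = c z \<Longrightarrow> c y = c x"
  shows "sorted_wrt (\<lambda>x y. (x, y) \<in> C) xs \<Longrightarrow>
    card (set xs \<inter> X) + asc r xs \<le> length xs + card (c ` (set xs \<inter> X)) \<and>
    ((\<forall>rs ys. xs = rs @ ys \<and> sorted_wrt (\<lambda>x y. (x, y) \<in> Q) rs \<longrightarrow> set rs \<inter> X = {}) \<and>
       set xs \<inter> X \<noteq> {} \<longrightarrow>
     card (set xs \<inter> X) + asc r xs < length xs + card (c ` (set xs \<inter> X)))"
proof (induction xs)
  case (Cons x xs)
  show ?case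
  proof (cases xs)
    case Nil
    have "x \<notin> X"
      if "\<forall>rs ys. [x] = rs @ ys \<and> sorted_wrt (\<lambda>x y. (x, y) \<in> Q) rs \<longrightarrow> set rs \<inter> X = {}"
      using that[rule_format, of "[x]" "[]"] by simp
    moreover have "card (set [x] \<inter> X) + asc r [x] \<le> length [x] + card (c ` (set [x] \<inter> X))"
      by (cases "x \<in> X") simp_all
    moreover have "x \<in> X" if "set [x] \<inter> X \<noteq> {}" using that by auto
    ultimately show ?thesis unfolding Nil by blast
  next
    case (Cons y ys)
    let ?m = "\<lambda>xs. card (set xs \<inter> X) + asc r xs" and ?b = "\<lambda>xs. length xs + card (c ` (set xs \<inter> X))"
    let ?G = "\<lambda>xs. \<forall>rs ys. xs = rs @ ys \<and> sorted_wrt (\<lambda>x y. (x, y) \<in> Q) rs \<longrightarrow> set rs \<inter> X = {}"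
    have sorted: "sorted_wrt (\<lambda>x y. (x, y) \<in> C) xs" and xC: "\<And>z. z \<in> set xs \<Longrightarrow> (x, z) \<in> C"
      using Cons.prems by auto
    note IH = Cons.IH[OF sorted]
    have x_notin: "x \<notin> set xs" using xC C_irrefl by blast
    have step: "(x, y) \<in> r - Id \<longleftrightarrow> (x, y) \<in> Q"
      using xC Cons by (auto simp: Q_def)
    have asc: "asc r (x # xs) = asc r xs + of_bool ((x, y) \<in> Q)"
      unfolding Cons asc_Cons_Cons step by simp
    \<comment> \<open>By transitivity, a \<open>Q\<close>-step from \<open>x\<close> extends each
      initial \<open>Q\<close>-run of \<open>xs\<close> to one of \<open>x # xs\<close>.\<close>
    have Q_run: "sorted_wrt (\<lambda>x y. (x, y) \<in> Q) (x # rs)"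
      if "(x, y) \<in> Q" "sorted_wrt (\<lambda>x y. (x, y) \<in> Q) rs" "xs = rs @ ts" for rs ts
      using that Cons by (cases rs) (auto intro: Q_trans)
    show ?thesis
    proof (cases "x \<in> X")
      case False
      then have eq: "set (x # xs) \<inter> X = set xs \<inter> X" by auto
      show ?thesis
      proof (cases "(x, y) \<in> Q")
        case True
        have "?G xs" if "?G (x # xs)"
        proof (intro allI impI)
          fix rs ts assume "xs = rs @ ts \<and> sorted_wrt (\<lambda>x y. (x, y) \<in> Q) rs"
          then have "set (x # rs) \<inter> X = {}"
            using that Q_run[OF True] by (metis append_Cons)
          then show "set rs \<inter> X = {}" by auto
        qed
        then show ?thesis using IH True unfolding eq asc by auto
      next
        case False
        \<comment> \<open>The length grows without a new ascent or a new element of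
          \<open>X\<close>: this is where slack arises.\<close>
        then show ?thesis using IH unfolding eq asc by auto
      qed
    next
      case xX: True
      have card: "card (set (x # xs) \<inter> X) = Suc (card (set xs \<inter> X))"
        using xX x_notin by simp
      \<comment> \<open>The run \<open>[x]\<close> meets \<open>X\<close>, so the strict bound is
        vacuous here.\<close>
      have "x # xs = [x] @ xs \<and> sorted_wrt (\<lambda>x y. (x, y) \<in> Q) [x] \<and> set [x] \<inter> X \<noteq> {}"
        using xX by simp
      then have nG: "\<not> ?G (x # xs)" by blast
      have img: "c ` (set (x # xs) \<inter> X) = insert (c x) (c ` (set xs \<inter> X))"
        using xX by auto
      have "?m (x # xs) \<le> ?b (x # xs)"
      proof (cases "c x \<in> c ` (set xs \<inter> X)")
        case False
        \<comment> \<open>The new label pays for \<open>x\<close>, the length for a possible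
          ascent.\<close>
        then have "card (c ` (set (x # xs) \<inter> X)) = Suc (card (c ` (set xs \<inter> X)))"
          unfolding img by simp
        then show ?thesis using IH unfolding card asc by auto
      next
        case True
        then have card': "card (c ` (set (x # xs) \<inter> X)) = card (c ` (set xs \<inter> X))"
          unfolding img by (simp add: insert_absorb)
        obtain z where z: "z \<in> set xs" "z \<in> X" "c z = c x" using True by auto
        show ?thesis
        proof (cases "(x, y) \<in> Q")
          case xyQ: True
          \<comment> \<open>Here \<open>x\<close> and the ascent must be paid by the length and the
            slack of \<open>xs\<close>. The slack exists: an element \<open>w\<close> of
            \<open>X\<close> in an initial run would lie between \<open>x\<close> and
            \<open>z\<close> and share their label, although \<open>(x, w)\<close> is in
            \<open>Q\<close>.\<close>
          have "?G xs"
          proof (intro allI impI)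
            fix rs ts assume rs: "xs = rs @ ts \<and> sorted_wrt (\<lambda>x y. (x, y) \<in> Q) rs"
            then have xQ: "(x, w) \<in> Q" if "w \<in> set rs" for w
              using that Q_run[OF xyQ] by auto
            have False if w: "w \<in> set rs" "w \<in> X" for w
            proof -
              have "z \<notin> set rs" using Qc[OF xQ[of z]] xX z by auto
              then have "(w, z) \<in> C"
                using rs z(1) w(1) sorted by (auto simp: sorted_wrt_append)
              then have "c w = c x"
                using Cc[of x w z] xC[of w] xX z w rs by auto
              then show False using Qc[OF xQ[OF w(1)] xX w(2)] by simp
            qed
            then show "set rs \<inter> X = {}" by blast
          qed
          then have "?m xs < ?b xs" using IH z by auto
          then show ?thesis unfolding card card' asc by simp
        next
          case False
          then show ?thesis using IH unfolding card card' asc by auto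
        qed
      qed
      then show ?thesis using nG by blast
    qed
  qed
qed simp

section \<open>Weak duality between chain families and antichain families\<close>

lemma adjacentable_sorted:
  "adjacentable S C xs \<Longrightarrow> sorted_wrt (\<lambda>x y. (x, y) \<in> C) xs"
  unfolding adjacentable_def
  by (subst successively_conv_sorted_wrt[symmetric]) (auto intro: C_trans transpI)

lemma h_ordered_sorted:
  "h_ordered S h xs \<longleftrightarrow> set xs \<subseteq> S \<and> sorted_wrt (\<lambda>x y. h x < h y) xs"
proof -
  have "successively (\<lambda>x y. h x < h y) xs \<longleftrightarrow> sorted_wrt (\<lambda>x y. h x < h y) xs"
    by (intro successively_conv_sorted_wrt) (auto intro: transpI)
  moreover have "distinct xs" if "sorted_wrt (\<lambda>x y. h x < h y) xs"
    using that by (induction xs) auto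
  ultimately show ?thesis by (auto simp: h_ordered_def)
qed

lemma desc_witness:
  obtains ys where "subseq ys xs" "sorted_wrt (\<lambda>x y. (x, y) \<notin> r - Id) ys" "length ys = desc r xs"
proof -
  have "desc r xs \<in> {length ys |ys. subseq ys xs \<and> sorted_wrt (\<lambda>x y. (x, y) \<notin> r - Id) ys}"
    unfolding desc_def by (rule Max_in[OF desc_set_wf])
  then show thesis using that by auto
qed

lemma desc_ge_length:
  "sorted_wrt (\<lambda>x y. (x, y) \<notin> r - Id) xs \<Longrightarrow> length xs \<le> desc r xs"
  unfolding desc_def by (rule Max_ge[OF desc_set_wf(1)]) auto

lemma sorted_wrt_subseq: "subseq ys xs \<Longrightarrow> sorted_wrt R xs \<Longrightarrow> sorted_wrt R ys"
proof (induction rule: list_emb.induct)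
  case (list_emb_Cons2 x y xs ys)
  then have "set xs \<subseteq> set ys" by (auto simp: subseq_conv_nths dest: in_set_nthsD)
  then show ?case using list_emb_Cons2 by auto
qed auto

text \<open>The condition in \<open>desc\<close> only forbids relations forward in the list. A
  \<open>Q\<close>-pair increases \<open>h\<close>, so in an \<open>h\<close>-ordered list it always
  points forward.\<close>

lemma desc_antichain:
  assumes "h_ordered S h xs"
  obtains Y where "Y \<subseteq> set xs" "card Y = desc r xs" "\<And>x y. x \<in> Y \<Longrightarrow> y \<in> Y \<Longrightarrow> (x, y) \<notin> Q"
proof -
  obtain ys where ys: "subseq ys xs" "sorted_wrt (\<lambda>x y. (x, y) \<notin> r - Id) ys"
      "length ys = desc r xs"
    by (rule desc_witness)
  obtain N where N: "ys = nths xs N" using ys(1) by (auto simp: subseq_conv_nths)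
  have sub: "set ys \<subseteq> set xs" unfolding N by (rule set_nths_subset)
  have "distinct ys" using assms unfolding N h_ordered_def by (simp add: distinct_nthsI)
  then have "card (set ys) = desc r xs" using ys(3) by (simp add: distinct_card)
  moreover have "(x, y) \<notin> Q" if xy: "x \<in> set ys" "y \<in> set ys" for x y
  proof
    assume "(x, y) \<in> Q"
    then have rxy: "(x, y) \<in> r - Id" and hxy: "h x < h y" using C_h by (auto simp: Q_def)
    have sorted: "sorted_wrt (\<lambda>x y. h x < h y) ys"
      using assms ys(1) by (metis h_ordered_sorted sorted_wrt_subseq)
    obtain i j where "i < length ys" "j < length ys" "x = ys ! i" "y = ys ! j"
      using xy by (metis in_set_conv_nth)
    then show False
      using rxy hxy sorted_wrt_nth_less[OF ys(2), of i j] sorted_wrt_nth_less[OF sorted, of j i]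
      by (metis less_asym less_irrefl linorder_neqE_nat)
  qed
  ultimately show thesis using that sub by blast
qed

text \<open>Each sequence of \<open>Ts\<close> is replaced by a \<open>Q\<close>-antichain realising
  its \<open>desc\<close>, and \<open>chain_meets_antichains\<close> is applied to each sequence of
  \<open>Ss\<close>, where at most \<open>l\<close> labels occur.\<close>

lemma family_weak_duality:
  assumes A: "Ss \<in> A_families S C k" and D: "Ts \<in> D_families S h C l"
  shows "(\<Sum>xs\<leftarrow>Ss. asc r xs) + (\<Sum>xs\<leftarrow>Ts. desc r xs) \<le> n + k * l"
proof -
  have lenS: "length Ss = k" and lenT: "length Ts = l"
    using A D by (auto simp: A_families_def D_families_def)
  have adj: "adjacentable S C (Ss ! i)" if "i < k" for i
    using A that lenS by (auto simp: A_families_def)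
  have ord: "h_ordered S h (Ts ! j)" if "j < l" for j
    using D that lenT by (auto simp: D_families_def)
  have "\<exists>Y. Y \<subseteq> set (Ts ! j) \<and> card Y = desc r (Ts ! j) \<and> (\<forall>x\<in>Y. \<forall>y\<in>Y. (x, y) \<notin> Q)"
    if "j < l" for j
    using desc_antichain[OF ord[OF that]] by metis
  then obtain Y where Y: "\<And>j. j < l \<Longrightarrow> Y j \<subseteq> set (Ts ! j)"
      "\<And>j. j < l \<Longrightarrow> card (Y j) = desc r (Ts ! j)"
      "\<And>j x y. j < l \<Longrightarrow> x \<in> Y j \<Longrightarrow> y \<in> Y j \<Longrightarrow> (x, y) \<notin> Q"
    by metis
  have disjY: "Y i \<inter> Y j = {}" if "i < l" "j < l" "i \<noteq> j" for i j
  proof -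
    have "set (Ts ! i) \<inter> set (Ts ! j) = {}"
      using D that lenT by (auto simp: D_families_def pairwise_disjoint_def)
    then show ?thesis using Y(1) that by blast
  qed
  have nso: "\<not> semi_overlapping C (Ts ! i) (Ts ! j)" if "i < l" "j < l" "i \<noteq> j" for i j
    using D that by (auto simp: D_families_def)
  define X where "X = (\<Union>j<l. Y j)"
  define c where "c x = (THE j. j < l \<and> x \<in> Y j)" for x
  have c: "c x = j" if "j < l" "x \<in> Y j" for x j
    unfolding c_def using that disjY by (intro the_equality) blast+
  have cX: "c x < l \<and> x \<in> Y (c x)" if "x \<in> X" for x
    using that c by (auto simp: X_def)
  have chain: "card (set (Ss ! i) \<inter> X) + asc r (Ss ! i) \<le> card (set (Ss ! i)) + l"
    if "i < k" for i
  proof -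
    have "c x \<noteq> c y" if "(x, y) \<in> Q" "x \<in> X" "y \<in> X" for x y
      using that cX[of x] cX[of y] Y(3)[of "c x" x y] by auto
    \<comment> \<open>An element of another sequence between two elements of one would give
      \<open>C\<close>-pairs in both directions, a semi-overlap.\<close>
    moreover have "c y = c x" if "(x, y) \<in> C" "(y, z) \<in> C" "x \<in> X" "y \<in> X" "z \<in> X" "c x = c z"
      for x y z
    proof (rule ccontr)
      assume "c y \<noteq> c x"
      moreover have "x \<in> set (Ts ! c x)" "z \<in> set (Ts ! c x)" "y \<in> set (Ts ! c y)"
        using that cX Y(1) by (metis subsetD)+
      ultimately show False
        using nso[of "c x" "c y"] cX that unfolding semi_overlapping_def by metis
    qed
    ultimately have "card (set (Ss ! i) \<inter> X) + asc r (Ss ! i)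
        \<le> length (Ss ! i) + card (c ` (set (Ss ! i) \<inter> X))"
      using chain_meets_antichains[of X c "Ss ! i"] adjacentable_sorted[OF adj[OF that]]
      by blast
    moreover have "card (c ` (set (Ss ! i) \<inter> X)) \<le> card {..<l}"
      using cX by (intro card_mono) auto
    moreover have "length (Ss ! i) = card (set (Ss ! i))"
      using adj[OF that] by (simp add: adjacentable_def distinct_card)
    ultimately show ?thesis by simp
  qed
  have finY: "finite (Y j)" if "j < l" for j
    using Y(1)[OF that] by (rule finite_subset) simp
  have "X \<subseteq> S"
    using Y(1) ord by (fastforce simp: X_def h_ordered_def)
  define U where "U = (\<Union>i<k. set (Ss ! i))"
  have "U \<subseteq> S"
    using adj by (auto simp: U_def adjacentable_def)
  have disjS: "set (Ss ! i) \<inter> set (Ss ! j) = {}" if "i < k" "j < k" "i \<noteq> j" for i j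
    using A that lenS by (auto simp: A_families_def pairwise_disjoint_def)
  have "(\<Sum>xs\<leftarrow>Ts. desc r xs) = (\<Sum>j<l. card (Y j))"
    using Y(2) lenT by (simp add: sum_list_sum_nth atLeast0LessThan)
  also have "\<dots> = card X"
    unfolding X_def using finY disjY by (subst card_UN_disjoint) auto
  finally have sumD: "(\<Sum>xs\<leftarrow>Ts. desc r xs) = card X" .
  have sumA: "(\<Sum>xs\<leftarrow>Ss. asc r xs) = (\<Sum>i<k. asc r (Ss ! i))"
    using lenS by (simp add: sum_list_sum_nth atLeast0LessThan)
  have cU: "card U = (\<Sum>i<k. card (set (Ss ! i)))"
    unfolding U_def using disjS by (subst card_UN_disjoint) auto
  have UX: "U \<inter> X = (\<Union>i<k. set (Ss ! i) \<inter> X)"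
    by (auto simp: U_def)
  have cUX: "card (U \<inter> X) = (\<Sum>i<k. card (set (Ss ! i) \<inter> X))"
    unfolding UX using disjS by (subst card_UN_disjoint) auto
  \<comment> \<open>The bounds add up over the disjoint chains to one for \<open>U\<close>;
    inclusion-exclusion for \<open>U\<close> and \<open>X\<close> inside \<open>S\<close> then
    brings in \<open>card X\<close>.\<close>
  have "(\<Sum>i<k. card (set (Ss ! i) \<inter> X) + asc r (Ss ! i)) \<le> (\<Sum>i<k. card (set (Ss ! i)) + l)"
    using chain by (intro sum_mono) auto
  then have "card (U \<inter> X) + (\<Sum>xs\<leftarrow>Ss. asc r xs) \<le> card U + k * l"
    by (simp add: sum.distrib sumA cU cUX)
  moreover have "card (U \<union> X) \<le> n"
    using \<open>U \<subseteq> S\<close> \<open>X \<subseteq> S\<close> fin card_S by (metis card_mono Un_least)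
  moreover have "card U + card X = card (U \<union> X) + card (U \<inter> X)"
    using \<open>U \<subseteq> S\<close> \<open>X \<subseteq> S\<close> fin by (intro card_Un_Int) (auto intro: finite_subset)
  ultimately show ?thesis using sumD by linarith
qed

lemma A'_attained: obtains Ss where "Ss \<in> A_families S C k" "A' S r C k = (\<Sum>xs\<leftarrow>Ss. asc r xs)"
proof -
  have "A' S r C k \<in> (\<lambda>Ss. \<Sum>xs\<leftarrow>Ss. asc r xs) ` A_families S C k"
    unfolding A'_def by (rule Max_in) (auto simp: A_families_wf[OF fin])
  then show thesis using that by auto
qed

lemma D'_attained: obtains Ts where "Ts \<in> D_families S h C l" "D' S r h C l = (\<Sum>xs\<leftarrow>Ts. desc r xs)"
proof -
  have "D' S r h C l \<in> (\<lambda>Ss. \<Sum>xs\<leftarrow>Ss. desc r xs) ` D_families S h C l"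
    unfolding D'_def by (rule Max_in) (auto simp: D_families_wf[OF fin])
  then show thesis using that by auto
qed

lemma weak_duality: "A' S r C k + D' S r h C l \<le> n + k * l"
proof -
  obtain Ss where "Ss \<in> A_families S C k" "A' S r C k = (\<Sum>xs\<leftarrow>Ss. asc r xs)"
    by (rule A'_attained)
  moreover obtain Ts where "Ts \<in> D_families S h C l" "D' S r h C l = (\<Sum>xs\<leftarrow>Ts. desc r xs)"
    by (rule D'_attained)
  ultimately show ?thesis using family_weak_duality by simp
qed

section \<open>Chain families from matchings\<close>

text \<open>\<open>h\<close> grows along the partial injection \<open>M\<close>, so its components
  are paths. Vertices are added in order of \<open>h\<close>; the clause on \<open>last\<close>
  supplies the chain to extend. Each chain contributes one to the sum beyond its
  \<open>Q\<close>-edges.\<close>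

lemma chain_cover:
  assumes "finite V" "V \<subseteq> S" "M \<subseteq> C" "M \<subseteq> V \<times> V" "single_valued M" "single_valued (M\<inverse>)"
  shows "\<exists>Ss. distinct (concat Ss) \<and> set (concat Ss) = V \<and>
    (\<forall>xs\<in>set Ss. xs \<noteq> [] \<and> successively (\<lambda>x y. (x, y) \<in> C) xs) \<and>
    V - Domain M \<subseteq> last ` set Ss \<and> length Ss + card M = card V \<and>
    (\<Sum>xs\<leftarrow>Ss. asc r xs) = card (M \<inter> Q) + length Ss"
  using assms
proof (induction V arbitrary: M rule: finite_ranking_induct[where f = h])
  case empty
  then show ?case by (intro exI[of _ "[]"]) auto
next
  case (insert z V)
  \<comment> \<open>\<open>z\<close> has the greatest height, so no edge leaves it.\<close>
  have "z \<notin> Domain M"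
    using insert.prems(2,3) insert.hyps(2) C_h by (fastforce simp: not_less)
  show ?case
  proof (cases "z \<in> V")
    case True
    then show ?thesis using insert by (simp add: insert_absorb)
  next
    case zV: False
    show ?thesis
    proof (cases "z \<in> Range M")
      case False
      then have "M \<subseteq> V \<times> V" using insert.prems(3) \<open>z \<notin> Domain M\<close> by blast
      then obtain Ss where Ss: "distinct (concat Ss)" "set (concat Ss) = V"
          "\<forall>xs\<in>set Ss. xs \<noteq> [] \<and> successively (\<lambda>x y. (x, y) \<in> C) xs"
          "V - Domain M \<subseteq> last ` set Ss" "length Ss + card M = card V"
          "(\<Sum>xs\<leftarrow>Ss. asc r xs) = card (M \<inter> Q) + length Ss"
        using insert.IH[of M] insert.prems by blast
      show ?thesis
        using Ss zV insert.hyps(1) by (intro exI[of _ "[z] # Ss"]) auto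
    next
      case True
      then obtain x where x: "(x, z) \<in> M" by blast
      have xz: "x \<noteq> z" using x \<open>z \<notin> Domain M\<close> by blast
      let ?M = "M - {(x, z)}"
      have "?M \<subseteq> V \<times> V"
      proof
        fix p assume p: "p \<in> ?M"
        obtain a b where ab: "p = (a, b)" by fastforce
        have "b \<noteq> z" using p x insert.prems(5) unfolding ab single_valued_def by blast
        moreover have "a \<noteq> z" using p \<open>z \<notin> Domain M\<close> unfolding ab by blast
        ultimately show "p \<in> V \<times> V" using p insert.prems(3) unfolding ab by blast
      qed
      moreover have "single_valued ?M" "single_valued (?M\<inverse>)"
        using insert.prems(4,5) by (auto simp: single_valued_def)
      ultimately obtain Ss where Ss: "distinct (concat Ss)" "set (concat Ss) = V"
          "\<forall>xs\<in>set Ss. xs \<noteq> [] \<and> successively (\<lambda>x y. (x, y) \<in> C) xs"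
          "V - Domain ?M \<subseteq> last ` set Ss" "length Ss + card ?M = card V"
          "(\<Sum>xs\<leftarrow>Ss. asc r xs) = card (?M \<inter> Q) + length Ss"
        using insert.IH[of ?M] insert.prems(1,2) by blast
      \<comment> \<open>Without its edge to \<open>z\<close>, the element \<open>x\<close> has no
        successor and so ends one of the chains.\<close>
      have "x \<in> V - Domain ?M"
        using x xz insert.prems(3,4) by (auto simp: single_valued_def)
      then obtain c where c: "c \<in> set Ss" "last c = x" using Ss(4) by auto
      then obtain Ss1 Ss2 where split: "Ss = Ss1 @ c # Ss2" by (meson split_list)
      have c_ne: "c \<noteq> []" using c Ss(3) by auto
      have finM: "finite M"
        using insert.prems(3) insert.hyps(1) by (meson finite_SigmaI finite_insert finite_subset)
      have cardM: "card M = Suc (card ?M)" using card.remove[OF finM x] .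
      have xzC: "(x, z) \<in> C" using x insert.prems(2) by blast
      have "M \<inter> Q = (if (x, z) \<in> r - Id then insert (x, z) (?M \<inter> Q) else ?M \<inter> Q)"
        using x xzC by (auto simp: Q_def)
      then have cardQ: "card (M \<inter> Q) = card (?M \<inter> Q) + of_bool ((x, z) \<in> r - Id)"
        using finM by auto
      let ?Ss = "Ss1 @ (c @ [z]) # Ss2"
      have "distinct (concat ?Ss)" "set (concat ?Ss) = insert z V"
        using Ss(1,2) zV split by auto
      moreover have "\<forall>xs\<in>set ?Ss. xs \<noteq> [] \<and> successively (\<lambda>x y. (x, y) \<in> C) xs"
        using Ss(3) split c c_ne xzC by (auto simp: successively_append_iff)
      moreover have "insert z V - Domain M \<subseteq> last ` set ?Ss"
      proof
        fix y assume y: "y \<in> insert z V - Domain M"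
        show "y \<in> last ` set ?Ss"
        proof (cases "y = z")
          case True
          then show ?thesis by force
        next
          case False
          then have "y \<in> last ` set Ss" using y Ss(4) by blast
          moreover have "y \<noteq> last c" using y x c(2) by blast
          ultimately show ?thesis using split by auto
        qed
      qed
      moreover have "length ?Ss + card M = card (insert z V)"
        using Ss(5) split cardM zV insert.hyps(1) by simp
      moreover have "(\<Sum>xs\<leftarrow>?Ss. asc r xs) = card (M \<inter> Q) + length ?Ss"
        using Ss(6) split cardQ c(2) asc_snoc[OF c_ne, of r z] by simp
      ultimately show ?thesis by blast
    qed
  qed
qed

text \<open>Off the loops, \<open>M\<close> decomposes the remaining elements into
  \<open>n - card M\<close> chains. The bound on \<open>k\<close> leaves room for these, and empty
  sequences fill the family.\<close>

lemma A'_ge_matching: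
  assumes M: "M \<subseteq> C \<union> Id" "M \<subseteq> S \<times> S" "single_valued M" "single_valued (M\<inverse>)"
    and k: "n \<le> card M + k"
  shows "card (M \<inter> Q) + n \<le> A' S r C k + card M"
proof -
  define V where "V = {x \<in> S. (x, x) \<notin> M}"
  have finV: "finite V" using fin by (simp add: V_def)
  have finM: "finite M" using M(2) fin by (meson finite_SigmaI finite_subset)
  \<comment> \<open>In a matching, no other edge touches an element that carries a loop.\<close>
  have "M - Id \<subseteq> V \<times> V"
  proof
    fix p assume p: "p \<in> M - Id"
    obtain a b where ab: "p = (a, b)" by fastforce
    have "(a, a) \<notin> M" using p M(3) unfolding ab single_valued_def by blast
    moreover have "(b, b) \<notin> M" using p M(4) unfolding ab single_valued_def by blast
    ultimately show "p \<in> V \<times> V" using p M(2) unfolding ab V_def by blast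
  qed
  then obtain Ss where Ss: "distinct (concat Ss)" "set (concat Ss) = V"
      "\<forall>xs\<in>set Ss. xs \<noteq> [] \<and> successively (\<lambda>x y. (x, y) \<in> C) xs"
      "length Ss + card (M - Id) = card V"
      "(\<Sum>xs\<leftarrow>Ss. asc r xs) = card ((M - Id) \<inter> Q) + length Ss"
  proof -
    have "single_valued (M - Id)" "single_valued ((M - Id)\<inverse>)"
      using M(3,4) unfolding single_valued_def by blast+
    moreover have "V \<subseteq> S" "M - Id \<subseteq> C" using M(1) by (auto simp: V_def)
    ultimately show thesis
      using chain_cover[of V "M - Id"] finV \<open>M - Id \<subseteq> V \<times> V\<close> that by blast
  qed
  have "M \<inter> Id = (\<lambda>x. (x, x)) ` (S - V)"
    using M(2) by (auto simp: V_def)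
  then have "card (M \<inter> Id) = card (S - V)"
    by (simp add: card_image inj_on_def)
  moreover have "card (S - V) + card V = n"
    using fin card_S by (subst card_Diff_subset) (auto simp: V_def card_mono)
  moreover have "card (M \<inter> Id) + card (M - Id) = card M"
    using finM by (subst card_Un_disjoint[symmetric]) (auto intro: arg_cong[of _ _ card])
  ultimately have len: "length Ss + card M = n" using Ss(4) by linarith
  let ?Ss = "Ss @ replicate (k - length Ss) []"
  have "length ?Ss = k" using len k by simp
  moreover have "distinct (concat ?Ss)" using Ss(1) by simp
  moreover have "adjacentable S C xs" if "xs \<in> set ?Ss" for xs
  proof (cases "xs = []")
    case False
    then have xs: "xs \<in> set Ss" using that by (auto simp: set_replicate_conv_if split: if_splits)
    then have "set xs \<subseteq> V" using Ss(2) by auto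
    then show ?thesis
      using xs Ss(1,3) by (auto simp: adjacentable_def V_def distinct_concat_iff)
  qed (simp add: adjacentable_def)
  ultimately have "?Ss \<in> A_families S C k"
    unfolding A_families_def using pairwise_disjoint_if_distinct_concat by blast
  then have "(\<Sum>xs\<leftarrow>?Ss. asc r xs) \<le> A' S r C k"
    unfolding A'_def using A_families_wf(1)[OF fin] by (intro Max_ge finite_imageI imageI)
  moreover have "(\<Sum>xs\<leftarrow>?Ss. asc r xs) = card (M \<inter> Q) + length Ss"
  proof -
    have "(M - Id) \<inter> Q = M \<inter> Q" by (auto simp: Q_def)
    then show ?thesis using Ss(5) by (simp add: sum_list_replicate)
  qed
  ultimately show ?thesis using len by linarith
qed

section \<open>Antichain families from dual solutions\<close>

lemma h_sorted_list:
  assumes "X \<subseteq> S"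
  obtains xs where "set xs = X" "length xs = card X" "sorted_wrt (\<lambda>x y. h x < h y) xs"
proof -
  have inj: "inj_on h X" using h assms by (meson bij_betw_def inj_on_subset)
  let ?g = "inv_into X h" and ?ks = "sorted_list_of_set (h ` X)"
  have finX: "finite X" using assms fin by (rule finite_subset)
  have "set (map ?g ?ks) = X" using inj finX by (simp add: inv_into_image_cancel)
  moreover have "length (map ?g ?ks) = card X" using inj by (simp add: card_image)
  moreover have "sorted_wrt (\<lambda>x y. h x < h y) (map ?g ?ks)"
    unfolding sorted_wrt_map
    by (rule sorted_wrt_mono_rel[OF _ strict_sorted_list_of_set])
      (use finX in \<open>auto simp: f_inv_into_f inj\<close>)
  ultimately show thesis by (rule that)
qed

text \<open>
  The antichains are the level sets of \<open>u\<close> on the elements whose loop constraint is tight.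
\<close>

lemma D'_ge_dual:
  fixes u v :: "'a \<Rightarrow> int"
  assumes nonneg: "\<And>x. x \<in> S \<Longrightarrow> 0 \<le> u x" "\<And>x. x \<in> S \<Longrightarrow> 0 \<le> v x"
    and loop: "\<And>x. x \<in> S \<Longrightarrow> int l - 1 \<le> u x + v x"
    and C_uv: "\<And>x y. (x, y) \<in> C \<Longrightarrow> int l - 1 \<le> u x + v y"
    and Q_uv: "\<And>x y. (x, y) \<in> Q \<Longrightarrow> int l \<le> u x + v y"
  shows "int l * int n - (\<Sum>x\<in>S. u x + v x) \<le> int (D' S r h C l)"
proof -
  define X where "X i = {x \<in> S. u x + v x = int l - 1 \<and> u x = int i}" for i
  have "X i \<subseteq> S" for i by (auto simp: X_def)
  then have "\<exists>xs. set xs = X i \<and> length xs = card (X i) \<and> sorted_wrt (\<lambda>x y. h x < h y) xs" for i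
    by (metis h_sorted_list)
  then obtain t where t: "\<And>i. set (t i) = X i" "\<And>i. length (t i) = card (X i)"
      "\<And>i. sorted_wrt (\<lambda>x y. h x < h y) (t i)"
    by metis
  let ?Ts = "map t [0..<l]"
  have "?Ts \<in> D_families S h C l"
  proof -
    have "h_ordered S h (t i)" for i
      using t by (auto simp: h_ordered_sorted X_def)
    moreover have "pairwise_disjoint ?Ts"
      by (auto simp: pairwise_disjoint_def t X_def)
    moreover have "\<not> semi_overlapping C (t i) (t j)" if "i \<noteq> j" for i j
    proof -
      \<comment> \<open>On tight elements \<open>v y = l - 1 - u y\<close>, so \<open>C_uv\<close>
        says that \<open>u\<close> cannot increase along \<open>C\<close>; pairs in both directions
        between two levels would make the levels equal.\<close>
      have le: "b \<le> a" if "x \<in> X a" "y \<in> X b" "(x, y) \<in> C" for a b x y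
        using that C_uv[of x y] by (auto simp: X_def)
      show ?thesis
      proof
        assume "semi_overlapping C (t i) (t j)"
        then obtain x y x' y' where "x \<in> X i" "y \<in> X j" "(x, y) \<in> C"
            "x' \<in> X i" "y' \<in> X j" "(y', x') \<in> C"
          by (auto simp: semi_overlapping_def t)
        then have "j \<le> i" "i \<le> j" using le by blast+
        then show False using \<open>i \<noteq> j\<close> by simp
      qed
    qed
    ultimately show ?thesis by (auto simp: D_families_def)
  qed
  then have "(\<Sum>xs\<leftarrow>?Ts. desc r xs) \<le> D' S r h C l"
    unfolding D'_def using D_families_wf(1)[OF fin] by (intro Max_ge finite_imageI imageI)
  moreover have "(\<Sum>xs\<leftarrow>?Ts. desc r xs) = (\<Sum>i<l. desc r (t i))"
    by (simp add: sum_list_sum_nth atLeast0LessThan)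
  moreover have "(\<Sum>i<l. card (X i)) \<le> (\<Sum>i<l. desc r (t i))"
  proof (rule sum_mono)
    fix i
    have "sorted_wrt (\<lambda>x y. (x, y) \<notin> r - Id) (t i)"
    proof (rule sorted_wrt_mono_rel[OF _ t(3)])
      fix x y assume xy: "x \<in> set (t i)" "y \<in> set (t i)" "h x < h y"
      show "(x, y) \<notin> r - Id"
      proof
        assume "(x, y) \<in> r - Id"
        \<comment> \<open>Within a level \<open>u x + v y = l - 1\<close>, which \<open>Q_uv\<close>
          forbids.\<close>
        then have "(x, y) \<in> Q" using r_C xy(3) by (auto simp: Q_def)
        then show False using Q_uv[of x y] xy by (auto simp: t X_def)
      qed
    qed
    then show "card (X i) \<le> desc r (t i)" using desc_ge_length t(2) by metis
  qed
  moreover have "(\<Sum>i<l. card (X i)) = card (\<Union>i<l. X i)"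
    using fin by (subst card_UN_disjoint) (auto simp: X_def)
  moreover have levels: "(\<Union>i<l. X i) = {x \<in> S. u x + v x = int l - 1}"
  proof -
    \<comment> \<open>Nonnegativity of \<open>u\<close> and \<open>v\<close> confines the levels to
      \<open>0\<close> through \<open>l - 1\<close>.\<close>
    have "x \<in> X (nat (u x)) \<and> nat (u x) < l" if "x \<in> S" "u x + v x = int l - 1" for x
      using that nonneg[of x] by (auto simp: X_def)
    then show ?thesis by (fastforce simp: X_def)
  qed
  moreover have "int l * int n - (\<Sum>x\<in>S. u x + v x) \<le> int (card {x \<in> S. u x + v x = int l - 1})"
  proof -
    have "int l * int n - (\<Sum>x\<in>S. u x + v x) = (\<Sum>x\<in>S. int l - (u x + v x))"
      using card_S by (simp add: sum_subtractf)
    \<comment> \<open>By \<open>loop\<close> a summand is at most one, and it is positive only for a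
      tight loop.\<close>
    also have "\<dots> \<le> (\<Sum>x\<in>S. of_bool (u x + v x = int l - 1))"
      using loop by (intro sum_mono) fastforce
    also have "\<dots> = int (card {x \<in> S. u x + v x = int l - 1})"
      using fin by (simp add: of_bool_def sum.If_cases Int_def)
    finally show ?thesis .
  qed
  ultimately show ?thesis unfolding levels by linarith
qed

section \<open>Tightness of the duality\<close>

lemma A'_ge_card: "n \<le> A' S r C k" if "n \<le> k"
  using A'_ge_matching[of "{}" k] that by (simp add: single_valued_def)

text \<open>For a matching that leaves \<open>k = n - card M\<close> chains, the number of ascents
  minus \<open>l * k\<close> is this weight minus \<open>(l - 1) * n\<close>: the slope
  \<open>l\<close> acts as the price of a chain.\<close>

lemma matching_weight:
  fixes f :: "'a \<Rightarrow> 'a"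
  defines "M \<equiv> {(x, f x) |x. x \<in> S \<and> (x, f x) \<in> C \<union> Id}"
  shows "(\<Sum>x\<in>S. if (x, f x) \<in> Q then int l else if (x, f x) \<in> C \<union> Id then int l - 1 else 0)
    = int (card (M \<inter> Q)) + (int l - 1) * int (card M)"
proof -
  let ?q = "{x \<in> S. (x, f x) \<in> Q}" and ?m = "{x \<in> S. (x, f x) \<in> C \<union> Id}"
  have "M = (\<lambda>x. (x, f x)) ` ?m" by (auto simp: M_def)
  then have cM: "card M = card ?m" by (simp add: card_image inj_on_def)
  have "M \<inter> Q = (\<lambda>x. (x, f x)) ` ?q" by (auto simp: M_def Q_def)
  then have cQ: "card (M \<inter> Q) = card ?q" by (simp add: card_image inj_on_def)
  have "(\<Sum>x\<in>S. if (x, f x) \<in> Q then int l else if (x, f x) \<in> C \<union> Id then int l - 1 else 0)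
    = (\<Sum>x\<in>S. of_bool (x \<in> ?q) + (int l - 1) * of_bool (x \<in> ?m))"
    by (intro sum.cong) (auto simp: Q_def)
  also have "\<dots> = int (card ?q) + (int l - 1) * int (card ?m)"
    using fin by (simp add: sum.distrib sum_distrib_left[symmetric] of_bool_def sum.If_cases Int_def
        del: of_bool_eq_iff cong: conj_cong)
  finally show ?thesis by (simp add: cM cQ)
qed

text \<open>The assignment problem on the complete bipartite graph with price \<open>l\<close> has
  an optimal permutation, whose pairs in \<open>C \<union> Id\<close> determine \<open>k\<close>;
  the equally valued dual solution bounds \<open>D'\<close> from below.\<close>

lemma tight_for_D: "\<exists>k. n + k * l \<le> A' S r C k + D' S r h C l"
proof (cases "l = 0")
  case True
  then show ?thesis using A'_ge_card[of n] by (intro exI[of _ n]) simp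
next
  case False
  define w where "w x y = (if (x, y) \<in> Q then int l else if (x, y) \<in> C \<union> Id then int l - 1 else 0)"
    for x y
  obtain f u v where f: "bij_betw f S S"
      and feas: "\<And>x y. (x, y) \<in> S \<times> S \<Longrightarrow> w x y \<le> u x + v y"
      and tight: "\<And>x. x \<in> S \<Longrightarrow> u x + v (f x) = w x (f x)"
    by (rule assignment_duality[of S S "S \<times> S" id w]) (use fin in auto)
  have w0: "0 \<le> w x y" for x y using False by (auto simp: w_def)
  \<comment> \<open>Moving \<open>c\<close> from \<open>v\<close> to \<open>u\<close> keeps all sums
    \<open>u x + v y\<close> and makes both parts nonnegative, since all weights are.\<close>
  define c where "c = Min (v ` S)"
  have c: "c \<le> v y" "0 \<le> u y + c" if "y \<in> S" for y
  proof -
    show "c \<le> v y" using that fin by (simp add: c_def)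
    have "c \<in> v ` S" using that fin unfolding c_def by (intro Min_in) auto
    then show "0 \<le> u y + c" using feas w0 that by (smt (verit) SigmaI imageE)
  qed
  define M where "M = {(x, f x) |x. x \<in> S \<and> (x, f x) \<in> C \<union> Id}"
  have fS: "f x \<in> S" if "x \<in> S" for x using f that by (auto simp: bij_betw_def)
  have M_S: "M \<subseteq> S \<times> S" using fS by (auto simp: M_def)
  have "card M \<le> card S"
  proof -
    have "M \<subseteq> (\<lambda>x. (x, f x)) ` S" by (auto simp: M_def)
    then show ?thesis using fin by (meson card_image_le card_mono finite_imageI order_trans)
  qed
  then obtain k where k: "n = card M + k" using card_S le_Suc_ex by blast
  have "card (M \<inter> Q) + n \<le> A' S r C k + card M"
  proof (rule A'_ge_matching)
    show "single_valued (M\<inverse>)"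
      using f by (auto simp: M_def single_valued_def bij_betw_def dest: inj_onD)
  qed (use M_S k in \<open>auto simp: M_def single_valued_def\<close>)
  moreover have "int l * int n - (\<Sum>x\<in>S. (u x + c) + (v x - c)) \<le> int (D' S r h C l)"
  proof (rule D'_ge_dual)
    show "int l - 1 \<le> u x + c + (v x - c)" if "x \<in> S" for x
      using feas[of x x] that False by (auto simp: w_def split: if_splits)
    show "int l - 1 \<le> u x + c + (v y - c)" if "(x, y) \<in> C" for x y
      using feas[of x y] that C_sub by (auto simp: w_def split: if_splits)
    show "int l \<le> u x + c + (v y - c)" if "(x, y) \<in> Q" for x y
      using feas[of x y] that C_sub by (auto simp: w_def Q_def split: if_splits)
  qed (use c in auto)
  moreover have "(\<Sum>x\<in>S. (u x + c) + (v x - c)) = int (card (M \<inter> Q)) + (int l - 1) * int (card M)"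
  proof -
    have "(\<Sum>x\<in>S. (u x + c) + (v x - c)) = sum u S + sum v S"
      by (simp add: sum.distrib)
    also have "sum v S = (\<Sum>x\<in>S. v (f x))"
      using sum.reindex_bij_betw[OF f, of v] by simp
    also have "sum u S + \<dots> = (\<Sum>x\<in>S. w x (f x))"
      using tight by (simp add: sum.distrib[symmetric])
    finally show ?thesis
      using matching_weight[of f l] by (simp add: w_def M_def)
  qed
  ultimately have "int n + int k * int l \<le> int (A' S r C k) + int (D' S r h C l)"
    using k by (simp add: algebra_simps)
  then show ?thesis by (intro exI[of _ k]) (simp flip: of_nat_mult of_nat_add)
qed

text \<open>
  Dummy vertices on both sides that must be matched to genuine ones force the matching of
  \<open>S\<close> to have exactly \<open>n - k\<close> edges; their dual values give the slope \<open>l\<close>.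
\<close>

lemma tight_for_A: "\<exists>l. n + k * l \<le> A' S r C k + D' S r h C l"
proof -
  consider (zero) "k = 0" | (large) "n \<le> k" | (main) "1 \<le> k" "k \<le> n" by linarith
  then show ?thesis
  proof cases
    case zero
    have h_le: "h x \<le> n" if "x \<in> S" for x
      using h that by (auto simp: bij_betw_def)
    \<comment> \<open>The dual \<open>u = n - h\<close>, \<open>v = h\<close> has all loops tight
      for \<open>l = n + 1\<close>; its level sets are singletons.\<close>
    have "int (n + 1) * int n - (\<Sum>x\<in>S. (int n - int (h x)) + int (h x)) \<le> int (D' S r h C (n + 1))"
      by (rule D'_ge_dual) (use h_le C_h in \<open>force simp: Q_def\<close>)+
    then have "int n \<le> int (D' S r h C (n + 1))"
      using card_S by (simp add: algebra_simps)
    then show ?thesis using zero by (intro exI[of _ "n + 1"]) simp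
  next
    case large
    then show ?thesis using A'_ge_card[of k] by (intro exI[of _ 0]) simp
  next
    case main
    define L where "L = S <+> {..<k}"
    define L where "L = S <+> {..<k}"
    define E where "E = {(p, q) \<in> L \<times> L. (case p of
      Inl x \<Rightarrow> (case q of Inl y \<Rightarrow> (x, y) \<in> C \<union> Id | Inr _ \<Rightarrow> True) | Inr _ \<Rightarrow> isl q)}"
    \<comment> \<open>The dummies fix the number of genuine edges, so only ascents carry
      weight.\<close>
    define w :: "'a + nat \<Rightarrow> 'a + nat \<Rightarrow> int" where "w p q = (case p of
      Inl x \<Rightarrow> (case q of Inl y \<Rightarrow> of_bool ((x, y) \<in> Q) | Inr _ \<Rightarrow> 0) | Inr _ \<Rightarrow> 0)" for p q
    have finL: "finite L" using fin by (simp add: L_def)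
    have E_L: "E \<subseteq> L \<times> L" by (auto simp: E_def)
    have E_Inl: "(Inl x, Inl y) \<in> E \<longleftrightarrow> x \<in> S \<and> y \<in> S \<and> (x, y) \<in> C \<union> Id" for x y
      by (auto simp: E_def L_def)
    have E_mixed: "(Inl x, Inr i) \<in> E \<longleftrightarrow> x \<in> S \<and> i < k" "(Inr i, Inl x) \<in> E \<longleftrightarrow> x \<in> S \<and> i < k"
      for x i by (auto simp: E_def L_def)
    have E_Inr: "(Inr i, Inr j) \<notin> E" for i j by (simp add: E_def)
    obtain e where e: "inj_on e {..<k}" "e ` {..<k} \<subseteq> S"
      using main(2) card_S fin inj_on_iff_card_le[of "{..<k}" S] by auto
    \<comment> \<open>An initial perfect matching: \<open>k\<close> chosen elements are swapped with
      the dummies and all others keep their loops.\<close>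
    define g where "g p = (case p of
      Inl x \<Rightarrow> if x \<in> e ` {..<k} then Inr (inv_into {..<k} e x) else Inl x
      | Inr i \<Rightarrow> Inl (e i))" for p
    have g_E: "(p, g p) \<in> E" if "p \<in> L" for p
    proof (cases p)
      case (Inl x)
      then have "x \<in> S" using that by (auto simp: L_def)
      moreover have "inv_into {..<k} e x < k" if "x \<in> e ` {..<k}"
        using inv_into_into[OF that] by simp
      ultimately show ?thesis by (simp add: Inl g_def E_Inl E_mixed)
    next
      case (Inr i)
      then have "i < k" using that by (auto simp: L_def)
      then show ?thesis using e(2) by (auto simp: Inr g_def E_mixed)
    qed
    have "g (g p) = p" if "p \<in> L" for p
      using that e(1) by (auto simp: g_def L_def f_inv_into_f)
    then have g_bij: "bij_betw g L L"
      using g_E E_L by (intro bij_betw_byWitness[where f' = g]) auto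
    obtain f u v where f: "bij_betw f L L" and f_E: "\<And>p. p \<in> L \<Longrightarrow> (p, f p) \<in> E"
        and feas: "\<And>p q. (p, q) \<in> E \<Longrightarrow> w p q \<le> u p + v q"
        and tight: "\<And>p. p \<in> L \<Longrightarrow> u p + v (f p) = w p (f p)"
      using assignment_duality[OF finL finL E_L g_bij g_E, where w = w] by blast

    define M where "M = {(x, y). x \<in> S \<and> f (Inl x) = Inl y}"
    define P where "P = {x \<in> S. \<not> isl (f (Inl x))}"
    have Inl_L: "Inl x \<in> L \<longleftrightarrow> x \<in> S" and Inr_L: "Inr i \<in> L \<longleftrightarrow> i < k" for x i
      by (auto simp: L_def)
    have f_inj: "p = q" if "f p = f q" "p \<in> L" "q \<in> L" for p q
      using f that by (auto simp: bij_betw_def dest: inj_onD)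
    have M_E: "(Inl x, Inl y) \<in> E" if "(x, y) \<in> M" for x y
      using that f_E[of "Inl x"] by (auto simp: M_def Inl_L)
    have f_Inr: "isl (f (Inr i))" if "i < k" for i
      using f_E[of "Inr i"] that E_Inr by (cases "f (Inr i)") (auto simp: Inr_L)
    \<comment> \<open>Dummies are never matched to each other, so exactly \<open>k\<close> genuine
      elements go to dummies.\<close>
    have "(\<lambda>x. f (Inl x)) ` P = Inr ` {..<k}"
    proof (intro equalityI subsetI)
      fix q assume "q \<in> (\<lambda>x. f (Inl x)) ` P"
      then obtain x where "x \<in> S" "\<not> isl q" "q = f (Inl x)" by (auto simp: P_def)
      moreover from this have "q \<in> L" using f_E[of "Inl x"] E_L by (auto simp: Inl_L)
      ultimately show "q \<in> Inr ` {..<k}" by (metis Inr_L image_eqI isl_def lessThan_iff sum.exhaust)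
    next
      fix q :: "'a + nat" assume "q \<in> Inr ` {..<k}"
      then obtain j where j: "q = Inr j" "j < k" by auto
      then have "q \<in> f ` L" using f by (simp add: bij_betw_def Inr_L)
      then obtain p where p: "p \<in> L" "f p = Inr j" using j by auto
      then obtain x where "p = Inl x"
        using f_Inr by (metis Inr_L isl_def old.sum.exhaust sum.disc(2))
      then show "q \<in> (\<lambda>x. f (Inl x)) ` P"
        using p j by (auto simp: P_def Inl_L intro!: image_eqI[of _ _ x])
    qed
    moreover have "inj_on (\<lambda>x. f (Inl x)) P"
      by (rule inj_onI) (use f_inj in \<open>fastforce simp: P_def Inl_L\<close>)
    ultimately have cardP: "card P = k"
      using card_image[of "\<lambda>x. f (Inl x)" P] by (simp add: card_image)
    have "M = (\<lambda>x. (x, projl (f (Inl x)))) ` (S - P)"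
      by (force simp: M_def P_def)
    then have "card M = card (S - P)" by (simp add: card_image inj_on_def)
    then have cardM: "card M + k = n"
      using cardP card_S fin main(2) by (simp add: card_Diff_subset P_def)
    have MQ: "card (M \<inter> Q) + n \<le> A' S r C k + card M"
    proof (rule A'_ge_matching)
      show "single_valued M" by (auto simp: M_def single_valued_def)
      show "single_valued (M\<inverse>)"
      proof (rule single_valuedI)
        fix y x x' assume "(y, x) \<in> M\<inverse>" "(y, x') \<in> M\<inverse>"
        then have "f (Inl x) = f (Inl x')" "x \<in> S" "x' \<in> S" by (auto simp: M_def)
        then show "x = x'" using f_inj[of "Inl x" "Inl x'"] by (simp add: Inl_L)
      qed
    qed (use M_E cardM in \<open>auto simp: E_Inl\<close>)

    \<comment> \<open>Dummy edges have weight zero, so adding \<open>b\<close> to the genuine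
      \<open>u\<close> and \<open>a\<close> to the genuine \<open>v\<close> makes both
      nonnegative.\<close>
    define a where "a = Min ((\<lambda>i. u (Inr i)) ` {..<k})"
    define b where "b = Min ((\<lambda>i. v (Inr i)) ` {..<k})"
    have "a \<in> (\<lambda>i. u (Inr i)) ` {..<k}" "b \<in> (\<lambda>i. v (Inr i)) ` {..<k}"
      unfolding a_def b_def using main(1) by (auto intro!: Min_in simp: lessThan_empty_iff)
    then obtain i j where i: "i < k" "a = u (Inr i)" and j: "j < k" "b = v (Inr j)" by auto
    have u_nonneg: "0 \<le> u (Inl x) + b" and v_nonneg: "0 \<le> v (Inl x) + a" if "x \<in> S" for x
      using feas[of "Inl x" "Inr j"] feas[of "Inr i" "Inl x"] that i j
      by (auto simp: E_mixed w_def)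
    \<comment> \<open>The total dual value is \<open>card (M \<inter> Q)\<close>, of which the
      dummies hold at least \<open>k * (a + b)\<close>; the shifts add \<open>n * (a + b)\<close>,
      leaving a factor \<open>n - k = card M\<close>.\<close>
    have sum_le: "(\<Sum>x\<in>S. (u (Inl x) + b) + (v (Inl x) + a))
      \<le> int (card (M \<inter> Q)) + int (card M) * (a + b)"
    proof -
      have sum_L: "sum z L = (\<Sum>x\<in>S. z (Inl x)) + (\<Sum>i<k. z (Inr i))" for z :: "'a + nat \<Rightarrow> int"
        unfolding L_def using fin by (simp add: sum.Plus)
      have "sum u L + sum v L = sum u L + (\<Sum>p\<in>L. v (f p))"
        using sum.reindex_bij_betw[OF f, of v] by simp
      also have "\<dots> = (\<Sum>p\<in>L. w p (f p))"
        using tight by (simp add: sum.distrib[symmetric])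
      also have "\<dots> = (\<Sum>x\<in>S. w (Inl x) (f (Inl x)))"
        unfolding sum_L by (simp add: w_def)
      also have "\<dots> = (\<Sum>x\<in>S. of_bool (x \<in> fst ` (M \<inter> Q)))"
        by (intro sum.cong) (force simp: w_def M_def split: sum.split)+
      also have "\<dots> = int (card (fst ` (M \<inter> Q)))"
      proof -
        have "fst ` (M \<inter> Q) \<subseteq> S" by (auto simp: M_def)
        then show ?thesis using fin by (simp add: of_bool_def sum.If_cases Int_absorb1)
      qed
      also have "card (fst ` (M \<inter> Q)) = card (M \<inter> Q)"
        by (intro card_image) (auto simp: inj_on_def M_def)
      finally have "sum u L + sum v L = int (card (M \<inter> Q))" .
      moreover have "int k * a \<le> (\<Sum>i<k. u (Inr i))"
        using sum_bounded_below[of "{..<k}" a "\<lambda>i. u (Inr i)"] by (simp add: a_def)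
      moreover have "int k * b \<le> (\<Sum>i<k. v (Inr i))"
        using sum_bounded_below[of "{..<k}" b "\<lambda>i. v (Inr i)"] by (simp add: b_def)
      moreover have "int n = int (card M) + int k" using cardM by simp
      ultimately show ?thesis
        using card_S by (simp add: sum_L sum.distrib algebra_simps)
    qed
    show ?thesis
    proof (cases "0 \<le> a + b")
      case True
      \<comment> \<open>The shifts raise the bound on \<open>C\<close> and loops from
        \<open>0\<close> to \<open>a + b = l - 1\<close>, and the bound on \<open>Q\<close> from
        \<open>1\<close> to \<open>l\<close>.\<close>
      define l where "l = nat (a + b) + 1"
      have l: "int l = a + b + 1" using True by (simp add: l_def)
      have "int l * int n - (\<Sum>x\<in>S. (u (Inl x) + b) + (v (Inl x) + a)) \<le> int (D' S r h C l)"
      proof (rule D'_ge_dual)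
        show "int l - 1 \<le> u (Inl x) + b + (v (Inl x) + a)" if "x \<in> S" for x
          using feas[of "Inl x" "Inl x"] that l
          by (auto simp: E_Inl w_def of_bool_def split: if_splits)
        show "int l - 1 \<le> u (Inl x) + b + (v (Inl y) + a)" if "(x, y) \<in> C" for x y
          using feas[of "Inl x" "Inl y"] that C_sub l
          by (auto simp: E_Inl w_def of_bool_def split: if_splits)
        show "int l \<le> u (Inl x) + b + (v (Inl y) + a)" if "(x, y) \<in> Q" for x y
          using feas[of "Inl x" "Inl y"] that C_sub l
          by (auto simp: E_Inl w_def Q_def split: if_splits)
      qed (use u_nonneg v_nonneg in auto)
      moreover have "int n = int (card M) + int k" using cardM by simp
      moreover have "int (card (M \<inter> Q)) + int n \<le> int (A' S r C k) + int (card M)"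
        using MQ by (simp flip: of_nat_add)
      ultimately have "int n + int k * int l \<le> int (A' S r C k) + int (D' S r h C l)"
        using sum_le unfolding l by (simp add: algebra_simps)
      then show ?thesis by (intro exI[of _ l]) (simp flip: of_nat_mult of_nat_add)
    next
      case False
      \<comment> \<open>A negative \<open>a + b\<close> forces every edge of \<open>M\<close> into
        \<open>Q\<close>, so \<open>A'\<close> is at least \<open>n\<close> and \<open>l = 0\<close>
        is tight.\<close>
      have "0 \<le> (\<Sum>x\<in>S. (u (Inl x) + b) + (v (Inl x) + a))"
        using u_nonneg v_nonneg by (intro sum_nonneg) (simp add: add_nonneg_nonneg)
      moreover have "int (card M) * (a + b) \<le> int (card M) * (- 1)"
        using False by (intro mult_left_mono) auto
      ultimately have "card M \<le> card (M \<inter> Q)" using sum_le by simp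
      then show ?thesis using MQ by (intro exI[of _ 0]) simp
    qed
  qed
qed

end

section \<open>The two conjugate partitions\<close>

theorem theorem2p1:
  fixes S :: "'a set" and r C :: "'a rel" and h :: "'a \<Rightarrow> nat" and n :: nat
    and lam mu :: "nat \<Rightarrow> int"
  assumes "finite S" and "card S = n" and "partial_order_on S r"
    and "bij_betw h S {1..n}"
    and "C \<subseteq> S \<times> S" and "\<And>x y. (x, y) \<in> C \<Longrightarrow> x \<noteq> y"
    and "\<And>x y. (x, y) \<in> r - Id \<Longrightarrow> h x < h y \<Longrightarrow> (x, y) \<in> C"
    and "\<And>x y. (x, y) \<in> C \<Longrightarrow> h x < h y"
    and "\<And>x y z. (x, y) \<in> C \<Longrightarrow> (y, z) \<in> C \<Longrightarrow> (x, z) \<in> C"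
    and "lam 1 = int (A' S r C 1)"
    and "\<And>k. k \<ge> 2 \<Longrightarrow> lam k = int (A' S r C k) - int (A' S r C (k - 1))"
    and "mu 1 = int (D' S r h C 1)"
    and "\<And>k. k \<ge> 2 \<Longrightarrow> mu k = int (D' S r h C k) - int (D' S r h C (k - 1))"
  shows "is_partition n lam \<and> is_partition n mu \<and> conjugate_of mu lam \<and> conjugate_of lam mu"
proof -
  interpret refined_order S r C h n
    using assms(1-9) by unfold_locales blast+
  let ?A = "\<lambda>k. int (A' S r C k)" and ?D = "\<lambda>l. int (D' S r h C l)"
  have weak: "?A k + ?D l \<le> int n + int k * int l" for k l
    using weak_duality[of k l] by (simp flip: of_nat_mult of_nat_add)
  interpret tight_pairs ?A ?D n
  proof
    show "\<exists>l. ?A k + ?D l = int n + int k * int l" for k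
      using tight_for_A[of k] weak_duality[of k]
      by (simp flip: of_nat_mult of_nat_add) (meson le_antisym)
    show "\<exists>k. ?A k + ?D l = int n + int k * int l" for l
      using tight_for_D[of l] weak_duality[of _ l]
      by (simp flip: of_nat_mult of_nat_add) (meson le_antisym)
  qed (use weak in \<open>auto simp: A'_def D'_def A_families_def D_families_def pairwise_disjoint_def\<close>)
  \<comment> \<open>Since \<open>A'\<close> vanishes at \<open>0\<close>, the separately given first
    term is also a difference.\<close>
  have lam: "lam k = ?A k - ?A (k - 1)" if "k \<ge> 1" for k
    using assms(10,11) A0 that by (cases "k = 1") auto
  have mu: "mu k = ?D k - ?D (k - 1)" if "k \<ge> 1" for k
    using assms(12,13) D0 that by (cases "k = 1") auto
  show ?thesis
    using is_partition_diff[OF lam] swap.is_partition_diff[OF mu]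
      conjugate_of_diff[OF lam mu] swap.conjugate_of_diff[OF mu lam]
    by blast
qed

end
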